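(* Let $\gamma>0$, let $u^*\in Y$ be the solution of the variational inequality (VI) described in the context, and let $G_\gamma(u)=\sup_{v\in K\cap Y}\big(\langle Au-f,u-v\rangle-\frac{1}{2\gamma}\|u-v\|_V^2\big)$ for $u\in V$. Then $$\Big(C_a-\frac{1}{2\gamma}\Big)\|u-u^*\|_V^2+\langle Au^*-f,u-u^*\rangle\le G_\gamma(u)\qquad\forall u\in V.$$ If $u\in K$, the duality product can be omitted, i.e. $\big(C_a-\frac{1}{2\gamma}\big)\|u-u^*\|_V^2\le G_\gamma(u)$ for all $u\in K$.
   Context: $\Omega\subset\mathbb{R}^n$ is a bounded Lipschitz domain, $V:=H^1(\Omega)$ with its usual norm $\|\cdot\|_V$, $V^*$ its dual, $\langle\cdot,\cdot\rangle$ the duality pairing. Data: $f\in L^2(\Omega)$, $h\in H^{1/2}(\partial\Omega)$, $\psi\in H^1(\Omega)$ with $\psi\le h$ on $\partial\Omega$ (traces), and $K:=\{u\in H^1(\Omega): u\ge\psi \text{ in }\Omega,\ u=h\text{ on }\partial\Omega\}$. $A\colon V\to V^*$ is the linear operator $\langle Au,w\rangle=\int_\Omega\nabla u\cdot\nabla w+\sum_{i=1}^n b_i\,\partial_{x_i}u\,w+k\,u\,w$, with constants $b_i,k\ge0$ such that there are $C_a,C_b>0$ with $\|Au-Av\|_{V^*}\le C_b\|u-v\|_V$ and $\langle Au-Av,u-v\rangle\ge C_a\|u-v\|_V^2$ for all $u,v\in V$. (VI): find $u\in K$ with $\langle Au-f,u-v\rangle\le0$ for all $v\in K$; its unique solution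 is $u^*$. Standing assumptions on the sets $X,Y$: $u^*\in X\cap Y$; $K\cap X\subset K\cap Y$; $K\cap Y$ is convex and closed in $V$. *)

theory Defs
  imports "HOL-Analysis.Analysis"
begin

text \<open>
  Elements of Lebesgue and Sobolev spaces are represented by functions on the whole of
  \<open>real ^ 'n\<close>, of which only the values on the relevant set (\<open>\<Omega>\<close> or its frontier) matter, and these
  only up to null sets.
\<close>

section \<open>Square-integrable functions\<close>

definition L2 :: "'a measure \<Rightarrow> ('a \<Rightarrow> real) set" where
  "L2 M = {u. u \<in> borel_measurable M \<and> integrable M (\<lambda>x. (u x)\<^sup>2)}"

definition L2_norm :: "'a measure \<Rightarrow> ('a \<Rightarrow> real) \<Rightarrow> real" where
  "L2_norm M u = sqrt (LINT x|M. (u x)\<^sup>2)"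


section \<open>Bounded Lipschitz domains\<close>

text \<open>Near each frontier point \<open>\<Omega>\<close> is the strict epigraph, in some direction \<open>e\<close>, of a Lipschitz
  function on the hyperplane orthogonal to \<open>e\<close>.\<close>

definition bounded_lipschitz_domain :: "(real ^ 'n) set \<Rightarrow> bool" where
  "bounded_lipschitz_domain \<Omega> \<longleftrightarrow>
     open \<Omega> \<and> connected \<Omega> \<and> \<Omega> \<noteq> {} \<and> bounded \<Omega> \<and>
     (\<forall>x0 \<in> frontier \<Omega>. \<exists>r>0. \<exists>e \<eta> L. norm e = 1 \<and> L-lipschitz_on {y. y \<bullet> e = 0} \<eta> \<and>
        (\<forall>x \<in> ball x0 r. x \<in> \<Omega> \<longleftrightarrow> \<eta> (x - (x \<bullet> e) *\<^sub>R e) < x \<bullet> e))"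


section \<open>Surface measure\<close>

text \<open>Hausdorff measure of dimension \<open>s\<close>, normalised so as to agree with \<open>s\<close>-dimensional volume. The
  covering sets must be required to be bounded because \<^const>\<open>diameter\<close> is 0 on unbounded sets; empty
  covering sets contribute nothing (this matters for \<open>s = 0\<close>, where \<open>0 ^ 0 = 1\<close>).\<close>

definition hausdorff_premeasure :: "nat \<Rightarrow> real \<Rightarrow> 'a::metric_space set \<Rightarrow> ennreal" where
  "hausdorff_premeasure s \<delta> A =
     (INF C \<in> {C :: nat \<Rightarrow> 'a set. A \<subseteq> (\<Union>i. C i) \<and> (\<forall>i. bounded (C i) \<and> diameter (C i) \<le> \<delta>)}.
        \<Sum>i. if C i = {} then 0 else ennreal (unit_ball_vol (real s) * (diameter (C i) / 2) ^ s))"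

definition hausdorff_outer :: "nat \<Rightarrow> 'a::metric_space set \<Rightarrow> ennreal" where
  "hausdorff_outer s A = (SUP \<delta> \<in> {0<..}. hausdorff_premeasure s \<delta> A)"

definition hausdorff_measure :: "nat \<Rightarrow> 'a::metric_space measure" where
  "hausdorff_measure s = measure_of UNIV (sets borel) (hausdorff_outer s)"

definition surface_measure :: "(real ^ 'n) set \<Rightarrow> (real ^ 'n) measure" where
  "surface_measure \<Omega> = restrict_space (hausdorff_measure (CARD('n) - 1)) (frontier \<Omega>)"


section \<open>Weak derivatives and the Sobolev space\<close>

definition partial :: "'n \<Rightarrow> (real ^ 'n \<Rightarrow> real) \<Rightarrow> real ^ 'n \<Rightarrow> real" where
  "partial i \<phi> x = frechet_derivative \<phi> (at x) (axis i 1)"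

primrec k_smooth :: "nat \<Rightarrow> (real ^ 'n \<Rightarrow> real) \<Rightarrow> bool" where
  "k_smooth 0 \<phi> \<longleftrightarrow> continuous_on UNIV \<phi>"
| "k_smooth (Suc m) \<phi> \<longleftrightarrow> (\<forall>x. \<phi> differentiable at x) \<and> (\<forall>i. k_smooth m (partial i \<phi>))"

definition smooth_fun :: "(real ^ 'n \<Rightarrow> real) \<Rightarrow> bool" where
  "smooth_fun \<phi> \<longleftrightarrow> (\<forall>m. k_smooth m \<phi>)"

definition test_functions :: "(real ^ 'n) set \<Rightarrow> (real ^ 'n \<Rightarrow> real) set" where
  "test_functions \<Omega> =
     {\<phi>. smooth_fun \<phi> \<and> compact (closure {x. \<phi> x \<noteq> 0}) \<and> closure {x. \<phi> x \<noteq> 0} \<subseteq> \<Omega>}"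

definition has_weak_partial ::
  "(real ^ 'n) set \<Rightarrow> 'n \<Rightarrow> (real ^ 'n \<Rightarrow> real) \<Rightarrow> (real ^ 'n \<Rightarrow> real) \<Rightarrow> bool" where
  "has_weak_partial \<Omega> i u g \<longleftrightarrow>
     (\<forall>\<phi> \<in> test_functions \<Omega>.
        (LINT x|lebesgue_on \<Omega>. u x * partial i \<phi> x) = - (LINT x|lebesgue_on \<Omega>. g x * \<phi> x))"

definition H1 :: "(real ^ 'n) set \<Rightarrow> (real ^ 'n \<Rightarrow> real) set" where
  "H1 \<Omega> = {u \<in> L2 (lebesgue_on \<Omega>). \<forall>i. \<exists>g \<in> L2 (lebesgue_on \<Omega>). has_weak_partial \<Omega> i u g}"

text \<open>A representative of the weak partial derivative, which is determined almost everywhere.\<close>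

definition weak_partial :: "(real ^ 'n) set \<Rightarrow> 'n \<Rightarrow> (real ^ 'n \<Rightarrow> real) \<Rightarrow> real ^ 'n \<Rightarrow> real" where
  "weak_partial \<Omega> i u = (SOME g. g \<in> L2 (lebesgue_on \<Omega>) \<and> has_weak_partial \<Omega> i u g)"

definition H1_norm :: "(real ^ 'n) set \<Rightarrow> (real ^ 'n \<Rightarrow> real) \<Rightarrow> real" where
  "H1_norm \<Omega> u =
     sqrt ((LINT x|lebesgue_on \<Omega>. (u x)\<^sup>2) +
           (\<Sum>i\<in>UNIV. LINT x|lebesgue_on \<Omega>. (weak_partial \<Omega> i u x)\<^sup>2))"

text \<open>Elements of the dual are represented by functionals on functions; the norm is extended-real
  valued, hence \<open>\<infinity>\<close> for an unbounded functional.\<close>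

definition H1_dual_norm :: "(real ^ 'n) set \<Rightarrow> ((real ^ 'n \<Rightarrow> real) \<Rightarrow> real) \<Rightarrow> ereal" where
  "H1_dual_norm \<Omega> F = (SUP w \<in> {w \<in> H1 \<Omega>. H1_norm \<Omega> w \<le> 1}. ereal \<bar>F w\<bar>)"

definition H1_convex :: "(real ^ 'n \<Rightarrow> real) set \<Rightarrow> bool" where
  "H1_convex S \<longleftrightarrow>
     (\<forall>u\<in>S. \<forall>v\<in>S. \<forall>t\<in>{0..1}. (\<lambda>x. (1 - t) * u x + t * v x) \<in> S)"

text \<open>Applied to sets of representatives, closedness also entails saturation under almost-everywhere
  equality on \<open>\<Omega>\<close>.\<close>

definition H1_closed :: "(real ^ 'n) set \<Rightarrow> (real ^ 'n \<Rightarrow> real) set \<Rightarrow> bool" where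
  "H1_closed \<Omega> S \<longleftrightarrow>
     (\<forall>s u. (\<forall>m::nat. s m \<in> S) \<and> u \<in> H1 \<Omega> \<and> (\<lambda>m. H1_norm \<Omega> (s m - u)) \<longlonglongrightarrow> 0 \<longrightarrow> u \<in> S)"


section \<open>Traces\<close>

text \<open>The trace operator is the continuous extension to \<open>H1 \<Omega>\<close> of the restriction to the frontier of
  functions smooth up to the frontier; \<open>boundary_trace \<Omega> u\<close> is determined almost everywhere.\<close>

definition has_trace :: "(real ^ 'n) set \<Rightarrow> (real ^ 'n \<Rightarrow> real) \<Rightarrow> (real ^ 'n \<Rightarrow> real) \<Rightarrow> bool" where
  "has_trace \<Omega> u g \<longleftrightarrow> u \<in> H1 \<Omega> \<and> g \<in> L2 (surface_measure \<Omega>) \<and>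
     (\<exists>\<phi> :: nat \<Rightarrow> real ^ 'n \<Rightarrow> real. (\<forall>m. smooth_fun (\<phi> m)) \<and>
        (\<lambda>m. H1_norm \<Omega> (\<phi> m - u)) \<longlonglongrightarrow> 0 \<and>
        (\<lambda>m. L2_norm (surface_measure \<Omega>) (\<phi> m - g)) \<longlonglongrightarrow> 0)"

definition boundary_trace :: "(real ^ 'n) set \<Rightarrow> (real ^ 'n \<Rightarrow> real) \<Rightarrow> real ^ 'n \<Rightarrow> real" where
  "boundary_trace \<Omega> u = (SOME g. has_trace \<Omega> u g)"

text \<open>The Sobolev--Slobodeckij space on the frontier: a set of dimension \<open>n - 1\<close> and order 1/2 give the
  exponent \<open>(n - 1) + 2 * (1/2) = n\<close>.\<close>

definition H_half_boundary :: "(real ^ 'n) set \<Rightarrow> (real ^ 'n \<Rightarrow> real) set" where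
  "H_half_boundary \<Omega> = {h \<in> L2 (surface_measure \<Omega>).
     (\<integral>\<^sup>+ x. \<integral>\<^sup>+ y. ennreal ((h x - h y)\<^sup>2 / dist x y ^ CARD('n)) \<partial>surface_measure \<Omega>
        \<partial>surface_measure \<Omega>) < \<infinity>}"


section \<open>The obstacle problem\<close>

definition obstacle_set ::
  "(real ^ 'n) set \<Rightarrow> (real ^ 'n \<Rightarrow> real) \<Rightarrow> (real ^ 'n \<Rightarrow> real) \<Rightarrow> (real ^ 'n \<Rightarrow> real) set" where
  "obstacle_set \<Omega> \<psi> h = {u \<in> H1 \<Omega>.
     (AE x in lebesgue_on \<Omega>. \<psi> x \<le> u x) \<and> (AE x in surface_measure \<Omega>. boundary_trace \<Omega> u x = h x)}"

definition A_op ::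
  "(real ^ 'n) set \<Rightarrow> ('n \<Rightarrow> real) \<Rightarrow> real \<Rightarrow> (real ^ 'n \<Rightarrow> real) \<Rightarrow> (real ^ 'n \<Rightarrow> real) \<Rightarrow> real" where
  "A_op \<Omega> b k u w =
     (LINT x|lebesgue_on \<Omega>.
        (\<Sum>i\<in>UNIV. weak_partial \<Omega> i u x * weak_partial \<Omega> i w x)
        + (\<Sum>i\<in>UNIV. b i * weak_partial \<Omega> i u x * w x) + k * u x * w x)"

definition L2_functional ::
  "(real ^ 'n) set \<Rightarrow> (real ^ 'n \<Rightarrow> real) \<Rightarrow> (real ^ 'n \<Rightarrow> real) \<Rightarrow> real" where
  "L2_functional \<Omega> f w = (LINT x|lebesgue_on \<Omega>. f x * w x)"

text \<open>Below, \<open>-\<close> is the pointwise difference of functions, respectively of functionals, and the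
  duality pairing is function application.\<close>

definition VI_solution ::
  "(real ^ 'n) set \<Rightarrow> ('n \<Rightarrow> real) \<Rightarrow> real \<Rightarrow> (real ^ 'n \<Rightarrow> real) \<Rightarrow> (real ^ 'n \<Rightarrow> real) set \<Rightarrow>
   (real ^ 'n \<Rightarrow> real) \<Rightarrow> bool" where
  "VI_solution \<Omega> b k f K u \<longleftrightarrow>
     u \<in> K \<and> (\<forall>v\<in>K. (A_op \<Omega> b k u - L2_functional \<Omega> f) (u - v) \<le> 0)"

definition G_gap ::
  "(real ^ 'n) set \<Rightarrow> ('n \<Rightarrow> real) \<Rightarrow> real \<Rightarrow> (real ^ 'n \<Rightarrow> real) \<Rightarrow> (real ^ 'n \<Rightarrow> real) set \<Rightarrow>
   real \<Rightarrow> (real ^ 'n \<Rightarrow> real) \<Rightarrow> ereal" where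
  "G_gap \<Omega> b k f S \<gamma> u =
     (SUP v\<in>S. ereal ((A_op \<Omega> b k u - L2_functional \<Omega> f) (u - v)
                        - 1 / (2 * \<gamma>) * (H1_norm \<Omega> (u - v))\<^sup>2))"

end

theory Submission
  imports Defs "HOL-Computational_Algebra.Polynomial" "HOL-Real_Asymp.Real_Asymp"
begin

text \<open>
  Taking \<open>v = us\<close> in the supremum and using strong monotonicity gives the first estimate. The second
  one needs that \<open>A us - f\<close> changes sign between \<open>us - u\<close> and \<open>u - us\<close>. Since \<^const>\<open>weak_partial\<close> is
  an arbitrary choice of representative, this rests on the almost everywhere uniqueness of weak
  derivatives, i.e. the fundamental lemma of the calculus of variations: test functions that are
  products of one-dimensional bumps converge boundedly to indicators of boxes, and boxes form an
  intersection-stable generator of the Borel sets.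
\<close>

section \<open>Smooth functions of one and several variables\<close>

text \<open>One-variable counterpart of \<open>k_smooth\<close>. The derivative enters as an
  existential witness, so closure proofs can supply it directly from the product or chain
  rule.\<close>

primrec k_smooth_real :: "nat \<Rightarrow> (real \<Rightarrow> real) \<Rightarrow> bool" where
  "k_smooth_real 0 f \<longleftrightarrow> continuous_on UNIV f"
| "k_smooth_real (Suc m) f \<longleftrightarrow>
     (\<exists>f'. (\<forall>t. (f has_real_derivative f' t) (at t)) \<and> k_smooth_real m f')"

text \<open>The product rule leaves undifferentiated factors behind; lowering their order lets an
  induction hypothesis of order \<open>m\<close> apply to them.\<close>

lemma k_smooth_real_SucD: "k_smooth_real (Suc m) f \<Longrightarrow> k_smooth_real m f"
proof (induction m arbitrary: f)
  case 0
  then show ?case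
    by (auto simp: continuous_on_eq_continuous_at intro: DERIV_isCont)
next
  case (Suc m)
  then show ?case
    by (metis k_smooth_real.simps(2))
qed

lemma k_smooth_real_const: "k_smooth_real m (\<lambda>_. c)"
proof (induction m arbitrary: c)
  case (Suc m)
  have "\<forall>t. ((\<lambda>_. c) has_real_derivative 0) (at t)"
    by simp
  with Suc[of 0] show ?case
    unfolding k_smooth_real.simps by fast
qed simp

lemma k_smooth_real_add:
  "k_smooth_real m f \<Longrightarrow> k_smooth_real m g \<Longrightarrow> k_smooth_real m (\<lambda>t. f t + g t)"
proof (induction m arbitrary: f g)
  case 0
  then show ?case by (simp add: continuous_on_add)
next
  case (Suc m)
  then obtain f' g' where
    "\<forall>t. (f has_real_derivative f' t) (at t)" "k_smooth_real m f'"
    "\<forall>t. (g has_real_derivative g' t) (at t)" "k_smooth_real m g'"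
    by auto
  with Suc.IH[of f' g'] show ?case
    unfolding k_smooth_real.simps
    by (intro exI[of _ "\<lambda>t. f' t + g' t"]) (auto intro: DERIV_add)
qed

lemma k_smooth_real_mult:
  "k_smooth_real m f \<Longrightarrow> k_smooth_real m g \<Longrightarrow> k_smooth_real m (\<lambda>t. f t * g t)"
proof (induction m arbitrary: f g)
  case 0
  then show ?case by (simp add: continuous_on_mult)
next
  case (Suc m)
  then obtain f' g' where
    f': "\<forall>t. (f has_real_derivative f' t) (at t)" "k_smooth_real m f'" and
    g': "\<forall>t. (g has_real_derivative g' t) (at t)" "k_smooth_real m g'"
    by auto
  have "k_smooth_real m (\<lambda>t. f' t * g t + g' t * f t)"
    using Suc f' g' k_smooth_real_SucD by (intro k_smooth_real_add Suc.IH) blast+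
  with f' g' show ?case
    unfolding k_smooth_real.simps
    by (intro exI[of _ "\<lambda>t. f' t * g t + g' t * f t"]) (auto intro: DERIV_mult)
qed

text \<open>Serves the rescaled and reflected arguments of \<open>interval_bump\<close>.\<close>

lemma k_smooth_real_affine:
  "k_smooth_real m f \<Longrightarrow> k_smooth_real m (\<lambda>t. f (c * t + d))"
proof (induction m arbitrary: f)
  case 0
  then show ?case
    by (auto intro!: continuous_on_compose2[of UNIV f] continuous_intros)
next
  case (Suc m)
  then obtain f' where
    f': "\<And>t. (f has_real_derivative f' t) (at t)" "k_smooth_real m f'"
    by auto
  have "((\<lambda>t. f (c * t + d)) has_real_derivative f' (c * t + d) * c) (at t)" for t
    by (rule DERIV_chain2[OF f'(1)]) (auto intro!: derivative_eq_intros)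
  moreover have "k_smooth_real m (\<lambda>t. f' (c * t + d) * c)"
    using Suc.IH[OF f'(2)] k_smooth_real_const k_smooth_real_mult by blast
  ultimately show ?case
    unfolding k_smooth_real.simps by (intro exI[of _ "\<lambda>t. f' (c * t + d) * c"]) simp
qed

lemma has_derivative_prod_components:
  fixes f f' :: "'n::finite \<Rightarrow> real \<Rightarrow> real"
  assumes "\<And>i t. (f i has_real_derivative f' i t) (at t)"
  shows "((\<lambda>x::real^'n. \<Prod>i\<in>UNIV. f i (x $ i)) has_derivative
    (\<lambda>y. \<Sum>i\<in>UNIV. (f' i (x $ i) * y $ i) * (\<Prod>j\<in>UNIV - {i}. f j (x $ j)))) (at x)"
proof (rule has_derivative_prod)
  fix i
  have "(f i has_derivative (\<lambda>h. f' i (x $ i) * h)) (at (x $ i))"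
    using assms by (simp add: has_field_derivative_def)
  moreover have "((\<lambda>x::real^'n. x $ i) has_derivative (\<lambda>y. y $ i)) (at x)"
    by (rule bounded_linear.has_derivative[OF bounded_linear_vec_nth]) (rule has_derivative_ident)
  ultimately show "((\<lambda>x::real^'n. f i (x $ i)) has_derivative (\<lambda>y. f' i (x $ i) * y $ i)) (at x)"
    using has_derivative_compose by blast
qed

text \<open>The right-hand side is again a product of one-variable functions, over an updated
  family, so the smoothness induction can be applied to it. In the sum from the product rule the
  direction \<open>axis j 1\<close> keeps only the index \<open>j\<close>.\<close>

lemma partial_prod_components:
  fixes f f' :: "'n::finite \<Rightarrow> real \<Rightarrow> real"
  assumes "\<And>i t. (f i has_real_derivative f' i t) (at t)"
  shows "partial j (\<lambda>x::real^'n. \<Prod>i\<in>UNIV. f i (x $ i)) =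
    (\<lambda>x. \<Prod>i\<in>UNIV. (f(j := f' j)) i (x $ i))"
proof
  fix x :: "real^'n"
  have "partial j (\<lambda>x::real^'n. \<Prod>i\<in>UNIV. f i (x $ i)) x =
    (\<Sum>i\<in>UNIV. (f' i (x $ i) * axis j 1 $ i) * (\<Prod>l\<in>UNIV - {i}. f l (x $ l)))"
    unfolding partial_def
    by (rule fun_cong[OF frechet_derivative_at[OF has_derivative_prod_components[OF assms], symmetric]])
  also have "\<dots> = (\<Sum>i\<in>UNIV. if i = j then f' i (x $ i) * (\<Prod>l\<in>UNIV - {i}. f l (x $ l)) else 0)"
    by (rule sum.cong) (auto simp: axis_def)
  also have "\<dots> = f' j (x $ j) * (\<Prod>l\<in>UNIV - {j}. f l (x $ l))"
    by simp
  also have "\<dots> = (\<Prod>i\<in>UNIV. (f(j := f' j)) i (x $ i))"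
    by (subst prod.remove[of UNIV j]) (auto intro!: prod.cong)
  finally show "partial j (\<lambda>x::real^'n. \<Prod>i\<in>UNIV. f i (x $ i)) x =
    (\<Prod>i\<in>UNIV. (f(j := f' j)) i (x $ i))" .
qed

lemma k_smooth_prod_components:
  fixes f :: "'n::finite \<Rightarrow> real \<Rightarrow> real"
  assumes "\<And>i. k_smooth_real m (f i)"
  shows "k_smooth m (\<lambda>x::real^'n. \<Prod>i\<in>UNIV. f i (x $ i))"
  using assms
proof (induction m arbitrary: f)
  case 0
  have "continuous_on UNIV (\<lambda>x::real^'n. f i (x $ i))" for i
    using 0[of i] by (auto intro!: continuous_on_compose2[of UNIV "f i"] continuous_intros)
  then show ?case
    by (auto intro: continuous_on_prod)
next
  case (Suc m)
  then obtain f' where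
    f': "\<And>i t. (f i has_real_derivative f' i t) (at t)" "\<And>i. k_smooth_real m (f' i)"
    by (simp only: k_smooth_real.simps) metis
  \<comment> \<open>Every member of \<open>f(j := f' j)\<close> has order \<open>m\<close>: the
    factor \<open>j\<close> by the choice of \<open>f'\<close>, the others by lowering their order
    by one.\<close>
  have "k_smooth m (partial j (\<lambda>x::real^'n. \<Prod>i\<in>UNIV. f i (x $ i)))" for j
    unfolding partial_prod_components[OF f'(1)]
    using f'(2) k_smooth_real_SucD[OF Suc.prems] by (intro Suc.IH) simp
  moreover have "(\<lambda>x::real^'n. \<Prod>i\<in>UNIV. f i (x $ i)) differentiable at x" for x
    using has_derivative_prod_components[OF f'(1)] by (rule differentiableI)
  ultimately show ?case by simp
qed


section \<open>Bump functions\<close>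

text \<open>For \<open>p = 1\<close> this is the classical flat function
  \<open>exp (- (1 / t))\<close> extended by zero. The polynomial in \<open>1 / t\<close> closes the
  family under differentiation, so smoothness of every order follows by one induction.\<close>

definition exp_bump :: "real poly \<Rightarrow> real \<Rightarrow> real" where
  "exp_bump p t = (if t \<le> 0 then 0 else poly p (1 / t) * exp (- (1 / t)))"

lemma tendsto_poly_times_exp_neg:
  fixes p :: "real poly"
  shows "((\<lambda>s. poly p s * exp (- s)) \<longlongrightarrow> 0) at_top"
proof -
  have "((\<lambda>s. \<Sum>i\<le>degree p. coeff p i * (s ^ i / exp s)) \<longlongrightarrow> (\<Sum>i\<le>degree p. coeff p i * 0)) at_top"
    by (intro tendsto_sum tendsto_mult tendsto_const tendsto_power_div_exp_0)
  then show ?thesis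
    by (simp add: poly_altdef exp_minus sum_distrib_right divide_inverse mult.assoc)
qed

text \<open>With \<open>s = 1 / t\<close>, the \<open>s\<close>-derivative of
  \<open>poly p s * exp (- s)\<close> has the polynomial \<open>pderiv p - p\<close>, and the inner
  derivative is \<open>- s^2\<close>; the factor \<open>[:0, 0, 1:]\<close> is \<open>s^2\<close>.
  At \<open>t = 0\<close> the two one-sided difference quotients are examined.\<close>

lemma exp_bump_has_derivative:
  "(exp_bump p has_real_derivative exp_bump ([:0, 0, 1:] * (p - pderiv p)) t) (at t)"
proof -
  consider "t < 0" | "t = 0" | "t > 0" by linarith
  then show ?thesis
  proof cases
    case 1
    have "((\<lambda>_. 0) has_real_derivative 0) (at t)" by simp
    moreover have "\<forall>\<^sub>F x in nhds t. exp_bump p x = 0"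
      using eventually_nhds_in_open[of "{..<0}" t] 1
      by (auto simp: exp_bump_def elim!: eventually_mono)
    ultimately show ?thesis
      using 1 by (subst DERIV_cong_ev[OF refl _ refl, where g = "\<lambda>_. 0"]) (auto simp: exp_bump_def)
  next
    case 3
    have "((\<lambda>t. poly p (1 / t) * exp (- (1 / t))) has_real_derivative
        poly ([:0, 0, 1:] * (p - pderiv p)) (1 / t) * exp (- (1 / t))) (at t)"
    proof -
      have "((\<lambda>s. poly p s * exp (- s)) has_real_derivative
          poly (pderiv p) s * exp (- s) + (exp (- s) * - 1) * poly p s) (at s)" for s
        by (intro DERIV_mult poly_DERIV DERIV_chain2[OF DERIV_exp] DERIV_minus DERIV_ident)
      moreover have "((\<lambda>t. 1 / t) has_real_derivative - (1 / t)\<^sup>2) (at t)"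
        using 3 DERIV_inverse[of t UNIV] by (simp add: divide_inverse power_inverse numeral_2_eq_2)
      ultimately show ?thesis
        by (rule DERIV_chain2[THEN DERIV_cong]) (simp add: algebra_simps power2_eq_square)
    qed
    moreover have "\<forall>\<^sub>F x in nhds t. exp_bump p x = poly p (1 / x) * exp (- (1 / x))"
      using eventually_nhds_in_open[of "{0<..}" t] 3
      by (auto simp: exp_bump_def elim!: eventually_mono)
    ultimately show ?thesis
      using 3 by (subst DERIV_cong_ev[OF refl _ refl]) (auto simp: exp_bump_def)
  next
    case 2
    have "((\<lambda>x. (exp_bump p x - exp_bump p 0) / (x - 0)) \<longlongrightarrow> 0) (at_left 0)"
      by (rule tendsto_eventually)
        (auto simp: eventually_at_left_real exp_bump_def eventually_at_filter)
    moreover have "((\<lambda>x. (exp_bump p x - exp_bump p 0) / (x - 0)) \<longlongrightarrow> 0) (at_right 0)"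
    proof -
      \<comment> \<open>The difference quotient divides by \<open>x\<close>, which is one more
        factor \<open>1 / x\<close>; hence the polynomial \<open>[:0, 1:]\<close>.\<close>
      have "((\<lambda>x. poly ([:0, 1:] * p) (inverse x) * exp (- inverse x)) \<longlongrightarrow> 0) (at_right (0::real))"
        using tendsto_poly_times_exp_neg filterlim_inverse_at_top_right
        by (rule filterlim_compose)
      then show ?thesis
        by (rule Lim_transform_eventually)
          (auto simp: eventually_at_filter exp_bump_def field_simps)
    qed
    ultimately have "((\<lambda>x. (exp_bump p x - exp_bump p 0) / (x - 0)) \<longlongrightarrow> 0) (at 0)"
      by (simp add: filterlim_split_at)
    then show ?thesis
      using 2 by (simp add: has_field_derivative_iff exp_bump_def)
  qed
qed

lemma k_smooth_real_exp_bump: "k_smooth_real m (exp_bump p)"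
proof (induction m arbitrary: p)
  case 0
  then show ?case
    using exp_bump_has_derivative
    by (auto simp: continuous_on_eq_continuous_at intro: DERIV_isCont)
next
  case (Suc m)
  then show ?case
    using exp_bump_has_derivative[of p] unfolding k_smooth_real.simps by blast
qed

lemma exp_bump_1_bounds: "0 \<le> exp_bump 1 t" "exp_bump 1 t \<le> 1"
  by (auto simp: exp_bump_def)

text \<open>The shift by \<open>1\<close> makes the support a compact subset of the open interval.\<close>

definition interval_bump :: "real \<Rightarrow> real \<Rightarrow> nat \<Rightarrow> real \<Rightarrow> real" where
  "interval_bump a b m t =
    exp_bump 1 (real (Suc m) * (t - a) - 1) *
    exp_bump 1 (real (Suc m) * (b - t) - 1)"

lemma interval_bump_bounds: "0 \<le> interval_bump a b m t" "interval_bump a b m t \<le> 1"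
  by (auto simp: interval_bump_def exp_bump_1_bounds intro: mult_le_one)

lemma k_smooth_real_interval_bump: "k_smooth_real l (interval_bump a b m)"
proof -
  \<comment> \<open>Both arguments are brought to the form \<open>c * t + d\<close>; the second
    slope is negative, a reflection.\<close>
  have "interval_bump a b m = (\<lambda>t. exp_bump 1 (real (Suc m) * t + (- real (Suc m) * a - 1)) *
      exp_bump 1 ((- real (Suc m)) * t + (real (Suc m) * b - 1)))"
    by (auto simp: interval_bump_def algebra_simps)
  then show ?thesis
    by (simp only:) (intro k_smooth_real_mult k_smooth_real_affine k_smooth_real_exp_bump)
qed

text \<open>A factor vanishes unless its shifted argument is positive; dividing by
  \<open>Suc m\<close> turns the shift into a margin at each end.\<close>

lemma interval_bump_nonzero:
  assumes "interval_bump a b m t \<noteq> 0"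
  shows "a + 1 / real (Suc m) < t" "t < b - 1 / real (Suc m)"
  using assms by (auto simp: interval_bump_def exp_bump_def field_simps split: if_splits)

text \<open>The argument tends to infinity, where \<open>exp (- (1 / s))\<close> tends to 1. It is
  applied with \<open>c\<close> the distance from an interior point to an endpoint.\<close>

lemma tendsto_exp_bump_1:
  assumes "c > 0"
  shows "(\<lambda>m. exp_bump 1 (real (Suc m) * c - 1)) \<longlonglongrightarrow> 1"
proof -
  have lim: "filterlim (\<lambda>m. real (Suc m) * c - 1) at_top sequentially"
    using assms by real_asymp
  have "((\<lambda>s::real. exp (- (1 / s))) \<longlongrightarrow> 1) at_top"
    by real_asymp
  moreover have "\<forall>\<^sub>F s::real in at_top. exp (- (1 / s)) = exp_bump 1 s"
    using eventually_gt_at_top[of 0] by eventually_elim (auto simp: exp_bump_def)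
  ultimately have "(exp_bump 1 \<longlongrightarrow> 1) at_top"
    by (rule Lim_transform_eventually)
  then show ?thesis
    using lim by (rule filterlim_compose)
qed

lemma tendsto_interval_bump:
  "(\<lambda>m. interval_bump a b m t) \<longlonglongrightarrow> indicator {a<..<b} t"
proof (cases "t \<in> {a<..<b}")
  case True
  then show ?thesis
    unfolding interval_bump_def
    using tendsto_mult[OF tendsto_exp_bump_1[of "t - a"] tendsto_exp_bump_1[of "b - t"]] by simp
next
  case False
  \<comment> \<open>The margin excludes the endpoints too, which is why the limit is the indicator
    of the open interval.\<close>
  have "interval_bump a b m t = 0" for m
  proof (rule ccontr)
    assume "interval_bump a b m t \<noteq> 0"
    moreover have "1 / real (Suc m) > 0"
      by simp
    ultimately have "a < t \<and> t < b"
      using interval_bump_nonzero[of a b m t] by linarith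
    with False show False
      by simp
  qed
  then show ?thesis
    using False by simp
qed

section \<open>Bump functions on boxes\<close>

definition box_bump :: "real^'n \<Rightarrow> real^'n \<Rightarrow> nat \<Rightarrow> real^'n \<Rightarrow> real" where
  "box_bump a b m x = (\<Prod>i\<in>UNIV. interval_bump (a $ i) (b $ i) m (x $ i))"

text \<open>The margins of the one-dimensional bumps confine the support to a closed box strictly
  inside \<open>box a b\<close>, so its closure is compact and stays in \<Omega>.\<close>

lemma box_bump_test_function:
  fixes a b :: "real^'n"
  assumes "box a b \<subseteq> \<Omega>"
  shows "box_bump a b m \<in> test_functions \<Omega>"
proof -
  have "smooth_fun (box_bump a b m)"
    unfolding smooth_fun_def box_bump_def[abs_def]
    by (intro allI k_smooth_prod_components k_smooth_real_interval_bump)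
  moreover have "{x. box_bump a b m x \<noteq> 0} \<subseteq>
      cbox (\<chi> i. a $ i + 1 / real (Suc m)) (\<chi> i. b $ i - 1 / real (Suc m))" (is "_ \<subseteq> ?C")
  proof
    fix x assume "x \<in> {x. box_bump a b m x \<noteq> 0}"
    then have "interval_bump (a $ i) (b $ i) m (x $ i) \<noteq> 0" for i
      by (auto simp: box_bump_def)
    from interval_bump_nonzero[OF this] show "x \<in> ?C"
      by (simp add: mem_box_cart less_imp_le)
  qed
  then have closure: "closure {x. box_bump a b m x \<noteq> 0} \<subseteq> ?C"
    by (intro closure_minimal closed_cbox)
  moreover have "?C \<subseteq> box a b"
  proof
    fix x assume "x \<in> ?C"
    then have "a $ i + 1 / real (Suc m) \<le> x $ i \<and> x $ i \<le> b $ i - 1 / real (Suc m)" for i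
      by (auto simp: mem_box_cart)
    moreover have "1 / real (Suc m) > 0" by simp
    ultimately have "a $ i < x $ i \<and> x $ i < b $ i" for i
      by (smt (verit))
    then show "x \<in> box a b"
      by (simp add: mem_box_cart)
  qed
  moreover have "compact (closure {x. box_bump a b m x \<noteq> 0})"
    using closure compact_cbox compact_Int_closed[OF compact_cbox closed_closure]
    by (metis inf.absorb2)
  ultimately show ?thesis
    using assms unfolding test_functions_def by blast
qed

lemma box_bump_bounds: "0 \<le> box_bump a b m x" "box_bump a b m x \<le> 1"
  unfolding box_bump_def by (auto intro!: prod_nonneg prod_le_1 interval_bump_bounds)

lemma tendsto_box_bump:
  fixes a b x :: "real^'n"
  shows "(\<lambda>m. box_bump a b m x) \<longlonglongrightarrow> indicator (box a b) x"
proof -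
  have "(\<lambda>m. box_bump a b m x) \<longlonglongrightarrow> (\<Prod>i\<in>UNIV. indicator {a $ i<..<b $ i} (x $ i))"
    unfolding box_bump_def by (intro tendsto_prod tendsto_interval_bump)
  also have "(\<Prod>i\<in>UNIV. indicator {a $ i<..<b $ i} (x $ i)) = (indicator (box a b) x :: real)"
    by (auto simp: indicator_def mem_box_cart prod_eq_1_iff)
  finally show ?thesis .
qed

section \<open>Uniqueness of weak derivatives\<close>

text \<open>Inside each box contained in \<open>S\<close>, a Dynkin-class argument extends the
  vanishing of integrals from boxes to Borel sets. Countably many such boxes exhaust
  \<open>S\<close>.\<close>

lemma AE_eq_0_if_box_integrals_eq_0:
  fixes f :: "'a::euclidean_space \<Rightarrow> real"
  assumes int: "integrable lborel f" and "open S"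
    and box: "\<And>a b. box a b \<subseteq> S \<Longrightarrow> (LINT x:box a b|lborel. f x) = 0"
  shows "AE x in lborel. x \<in> S \<longrightarrow> f x = 0"
proof -
  have AE_box: "AE x in lborel. x \<in> box c d \<longrightarrow> f x = 0" if "box c d \<subseteq> S" for c d
  proof -
    \<comment> \<open>Cutting off to \<open>box c d\<close> makes the integral over the whole space
      a box integral known to vanish, as the complement step requires.\<close>
    define F where "F = (\<lambda>x. indicator (box c d) x * f x)"
    have F: "integrable lborel F"
      unfolding F_def using int by (simp add: integrable_real_mult_indicator mult.commute)
    have F_set: "set_integrable lborel A F" if "A \<in> sets borel" for A
      unfolding set_integrable_def using that F by (intro integrable_mult_indicator) auto
    have F_Int: "(LINT x:A|lborel. F x) = (LINT x:A \<inter> box c d|lborel. f x)" for A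
      unfolding set_lebesgue_integral_def F_def
      by (intro Bochner_Integration.integral_cong) (auto simp: indicator_def)
    have "(LINT x:A|lborel. F x) = 0" if "A \<in> sets borel" for A
    proof -
      have stable: "Int_stable (range (\<lambda>(a, b). box a b :: 'a set))"
        by (auto simp: Int_stable_def box_Int_box)
      have A: "A \<in> sigma_sets UNIV (range (\<lambda>(a, b). box a b))"
        using that by (simp add: borel_eq_box)
      show ?thesis
      proof (rule sigma_sets_induct_disjoint[OF stable _ A])
        fix A :: "'a set" assume "A \<in> range (\<lambda>(a, b). box a b)"
        then obtain a b where "A = box a b" by auto
        then have "\<exists>p q. A \<inter> box c d = box p q"
          using box_Int_box by blast
        then obtain p q where pq: "A \<inter> box c d = box p q"
          by blast
        then have "box p q \<subseteq> S" using \<open>box c d \<subseteq> S\<close> by blast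
        then show "(LINT x:A|lborel. F x) = 0"
          unfolding F_Int pq by (rule box)
      next
        fix A :: "'a set"
        assume "A \<in> sigma_sets UNIV (range (\<lambda>(a, b). box a b))" and A: "(LINT x:A|lborel. F x) = 0"
        then have A_borel: "A \<in> sets borel"
          by (simp add: borel_eq_box)
        have "(LINT x:A \<union> (UNIV - A)|lborel. F x) =
            (LINT x:A|lborel. F x) + (LINT x:UNIV - A|lborel. F x)"
          using A_borel by (intro set_integral_Un F_set) auto
        moreover have "(LINT x:A \<union> (UNIV - A)|lborel. F x) = 0"
          unfolding F_Int using box[OF \<open>box c d \<subseteq> S\<close>] by simp
        ultimately show "(LINT x:UNIV - A|lborel. F x) = 0"
          using A by simp
      next
        fix A :: "nat \<Rightarrow> 'a set"
        assume disj: "disjoint_family A"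
          and "range A \<subseteq> sigma_sets UNIV (range (\<lambda>(a, b). box a b))"
          and A: "\<And>i. (LINT x:A i|lborel. F x) = 0"
        then have A_borel: "A i \<in> sets borel" for i
          by (auto simp: borel_eq_box)
        have "(LINT x:(\<Union>i. A i)|lborel. F x) = (\<Sum>i. (LINT x:(A i)|lborel. F x))"
          using A_borel disj
          by (intro lebesgue_integral_countable_add F_set) (auto simp: disjoint_family_on_def)
        then show "(LINT x:(\<Union>i. A i)|lborel. F x) = 0"
          using A by simp
      qed (auto simp: set_lebesgue_integral_def)
    qed
    \<comment> \<open>\<open>F\<close> and the zero function have the same integral over every Borel
      set.\<close>
    then have "AE x in lborel. F x = 0"
      using F by (intro density_unique_real) (auto simp: set_lebesgue_integral_def)
    then show ?thesis
      by eventually_elim (auto simp: F_def)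
  qed
  obtain D where D: "countable D" "D \<subseteq> Pow S" "\<And>X. X \<in> D \<Longrightarrow> \<exists>a b. X = box a b" "\<Union>D = S"
    using open_countable_Union_open_box[OF \<open>open S\<close>] by metis
  have "AE x in lborel. x \<in> X \<longrightarrow> f x = 0" if "X \<in> D" for X
    using AE_box D(2,3) that by blast
  \<comment> \<open>Countability of \<open>D\<close> merges the exceptional null sets into
    one.\<close>
  then have "AE x in lborel. \<forall>X\<in>D. x \<in> X \<longrightarrow> f x = 0"
    unfolding AE_ball_countable[OF D(1)] by blast
  then show ?thesis
    by eventually_elim (use D(4) in blast)
qed

lemma box_bump_borel_measurable [measurable]: "box_bump a b m \<in> borel_measurable borel"
proof -
  have "k_smooth 0 (box_bump a b m)"
    unfolding box_bump_def[abs_def]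
    by (intro k_smooth_prod_components k_smooth_real_interval_bump)
  then show ?thesis
    by (simp add: borel_measurable_continuous_onI)
qed

text \<open>The zero extension of \<open>g\<close> is only Lebesgue measurable, so it is replaced by
  a Borel representative \<open>G\<close>. Testing with \<open>box_bump\<close> and passing to the
  limit shows that \<open>G\<close> has vanishing integrals over the boxes inside \<Omega>.\<close>

lemma fundamental_lemma_calculus_of_variations:
  fixes g :: "real^'n \<Rightarrow> real"
  assumes "open \<Omega>" and int: "integrable (lebesgue_on \<Omega>) g"
    and zero: "\<And>\<phi>. \<phi> \<in> test_functions \<Omega> \<Longrightarrow> (LINT x|lebesgue_on \<Omega>. g x * \<phi> x) = 0"
  shows "AE x in lebesgue_on \<Omega>. g x = 0"
proof -
  have \<Omega>: "\<Omega> \<inter> space lebesgue \<in> sets lebesgue"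
    using \<open>open \<Omega>\<close> by simp
  have int': "integrable lebesgue (\<lambda>x. indicator \<Omega> x * g x)"
    using int unfolding integrable_restrict_space[OF \<Omega>] by simp
  then obtain G where G: "G \<in> borel_measurable lborel" "AE x in lborel. indicator \<Omega> x * g x = G x"
    using completion_ex_borel_measurable_real by blast
  note G(1)[measurable]
  have AE_G: "AE x in lebesgue. indicator \<Omega> x * g x = G x"
    using G(2) by (rule AE_completion)
  have G_lebesgue: "G \<in> borel_measurable lebesgue"
    using G(1) by (rule measurable_completion)
  have int_G: "integrable lborel G"
    using int' integrable_cong_AE[OF _ G_lebesgue AE_G] integrable_completion[OF G(1)] by auto
  have "(LINT x:box a b|lborel. G x) = 0" if "box a b \<subseteq> \<Omega>" for a b
  proof -
    have "(LINT x|lborel. G x * box_bump a b m x) = 0" for m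
    proof -
      note \<phi> = box_bump_test_function[OF that, of m]
      have "(LINT x|lborel. G x * box_bump a b m x) = (LINT x|lebesgue. G x * box_bump a b m x)"
        by (rule integral_completion[symmetric]) measurable
      also have "\<dots> = (LINT x|lebesgue. indicator \<Omega> x * g x * box_bump a b m x)"
      proof (rule integral_cong_AE)
        have [measurable]: "box_bump a b m \<in> borel_measurable lebesgue"
          by (rule measurable_completion) simp
        show "(\<lambda>x. G x * box_bump a b m x) \<in> borel_measurable lebesgue"
          "(\<lambda>x. indicator \<Omega> x * g x * box_bump a b m x) \<in> borel_measurable lebesgue"
          using G_lebesgue borel_measurable_integrable[OF int'] by measurable
        show "AE x in lebesgue. G x * box_bump a b m x = indicator \<Omega> x * g x * box_bump a b m x"
          using AE_G by eventually_elim simp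
      qed
      also have "\<dots> = (LINT x|lebesgue_on \<Omega>. g x * box_bump a b m x)"
        unfolding integral_restrict_space[OF \<Omega>] by (simp add: mult.assoc)
      also have "\<dots> = 0"
        by (rule zero[OF \<phi>])
      finally show ?thesis .
    qed
    moreover have "(\<lambda>m. LINT x|lborel. G x * box_bump a b m x)
        \<longlonglongrightarrow> (LINT x|lborel. G x * indicator (box a b) x)"
    \<comment> \<open>The bumps take values between 0 and 1, so the norm of \<open>G\<close>
      dominates.\<close>
    proof (rule integral_dominated_convergence)
      show "integrable lborel (\<lambda>x. norm (G x))"
        using int_G by simp
      show "AE x in lborel. (\<lambda>m. G x * box_bump a b m x) \<longlonglongrightarrow> G x * indicator (box a b) x"
        by (intro AE_I2 tendsto_mult tendsto_const tendsto_box_bump)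
      show "AE x in lborel. norm (G x * box_bump a b m x) \<le> norm (G x)" for m
        by (rule AE_I2) (simp add: abs_mult box_bump_bounds mult_left_le)
    qed measurable
    ultimately have "(LINT x|lborel. G x * indicator (box a b) x) = 0"
      by (simp add: LIMSEQ_const_iff)
    then show ?thesis
      by (simp add: set_lebesgue_integral_def mult.commute)
  qed
  then have "AE x in lborel. x \<in> \<Omega> \<longrightarrow> G x = 0"
    by (rule AE_eq_0_if_box_integrals_eq_0[OF int_G \<open>open \<Omega>\<close>])
  then have "AE x in lebesgue. x \<in> \<Omega> \<longrightarrow> G x = 0"
    by (rule AE_completion)
  with AE_G have "AE x in lebesgue. x \<in> \<Omega> \<longrightarrow> g x = 0"
    by eventually_elim auto
  then show ?thesis
    by (simp add: AE_restrict_space_iff[OF \<Omega>])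
qed

section \<open>Differences, negation and uniqueness of weak partial derivatives\<close>

lemma L2_uminus: "u \<in> L2 M \<Longrightarrow> (\<lambda>x. - u x) \<in> L2 M"
  by (simp add: L2_def)

lemma L2_diff:
  assumes "u \<in> L2 M" "v \<in> L2 M"
  shows "(\<lambda>x. u x - v x) \<in> L2 M"
proof -
  have [measurable]: "u \<in> borel_measurable M" "v \<in> borel_measurable M"
    and int: "integrable M (\<lambda>x. (u x)\<^sup>2)" "integrable M (\<lambda>x. (v x)\<^sup>2)"
    using assms by (auto simp: L2_def)
  have "integrable M (\<lambda>x. (u x - v x)\<^sup>2)"
  proof (rule Bochner_Integration.integrable_bound)
    show "integrable M (\<lambda>x. 2 * (u x)\<^sup>2 + 2 * (v x)\<^sup>2)"
      using int by simp
    \<comment> \<open>The right side exceeds the left by the square of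
      \<open>u x + v x\<close>.\<close>
    have "(u x - v x)\<^sup>2 \<le> 2 * (u x)\<^sup>2 + 2 * (v x)\<^sup>2" for x
      using zero_le_power2[of "u x + v x"] by (simp add: power2_eq_square algebra_simps)
    then show "AE x in M. norm ((u x - v x)\<^sup>2) \<le> norm (2 * (u x)\<^sup>2 + 2 * (v x)\<^sup>2)"
      by (auto simp: abs_le_iff intro: order_trans)
  qed measurable
  then show ?thesis
    by (simp add: L2_def)
qed

text \<open>On the bounded set \<Omega> the measure is finite, so square-integrable functions are
  integrable, and \<phi> is bounded on the compact closure. This justifies splitting integrals of
  differences against test functions and their partials.\<close>

lemma integrable_L2_mult_continuous:
  fixes g \<phi> :: "real^'n \<Rightarrow> real"
  assumes "open \<Omega>" "bounded \<Omega>" "g \<in> L2 (lebesgue_on \<Omega>)"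
    and cont: "continuous_on UNIV \<phi>"
  shows "integrable (lebesgue_on \<Omega>) (\<lambda>x. g x * \<phi> x)"
proof -
  interpret finite_measure "lebesgue_on \<Omega>"
    using assms by (intro finite_measure_lebesgue_on bounded_set_imp_lmeasurable) auto
  have [measurable]: "\<phi> \<in> borel_measurable (lebesgue_on \<Omega>)"
    using borel_measurable_continuous_onI[OF cont]
    by (intro measurable_restrict_space1 measurable_completion) simp
  have int: "integrable (lebesgue_on \<Omega>) g"
    using assms(3) square_integrable_imp_integrable unfolding L2_def by blast
  note borel_measurable_integrable[OF this, measurable]
  have "compact (closure \<Omega>)"
    using \<open>bounded \<Omega>\<close> by (simp add: compact_closure)
  then have "bounded (\<phi> ` closure \<Omega>)"
    using cont by (meson compact_continuous_image compact_imp_bounded continuous_on_subset subset_UNIV)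
  then obtain B where B: "\<And>x. x \<in> closure \<Omega> \<Longrightarrow> \<bar>\<phi> x\<bar> \<le> B"
    by (auto simp: bounded_iff)
  show ?thesis
  proof (rule Bochner_Integration.integrable_bound)
    show "integrable (lebesgue_on \<Omega>) (\<lambda>x. B * g x)"
      using int by simp
    show "AE x in lebesgue_on \<Omega>. norm (g x * \<phi> x) \<le> norm (B * g x)"
    proof (rule AE_I2)
      fix x assume "x \<in> space (lebesgue_on \<Omega>)"
      then have "\<bar>\<phi> x\<bar> \<le> \<bar>B\<bar>"
        using B[of x] closure_subset by force
      then show "norm (g x * \<phi> x) \<le> norm (B * g x)"
        by (simp add: abs_mult mult.commute[of "\<bar>g x\<bar>"] mult_right_mono)
    qed
  qed measurable
qed

lemma test_functions_continuous:
  assumes "\<phi> \<in> test_functions \<Omega>"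
  shows "continuous_on UNIV \<phi>" "continuous_on UNIV (partial i \<phi>)"
proof -
  have "k_smooth 0 \<phi>" "k_smooth (Suc 0) \<phi>"
    using assms by (auto simp: test_functions_def smooth_fun_def simp del: k_smooth.simps)
  then show "continuous_on UNIV \<phi>" "continuous_on UNIV (partial i \<phi>)"
    by auto
qed

lemma has_weak_partial_unique:
  assumes "open \<Omega>" "bounded \<Omega>"
    and "g \<in> L2 (lebesgue_on \<Omega>)" "has_weak_partial \<Omega> i u g"
    and "g' \<in> L2 (lebesgue_on \<Omega>)" "has_weak_partial \<Omega> i u g'"
  shows "AE x in lebesgue_on \<Omega>. g x = g' x"
proof -
  have "(LINT x|lebesgue_on \<Omega>. (g x - g' x) * \<phi> x) = 0" if "\<phi> \<in> test_functions \<Omega>" for \<phi>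
  proof -
    have "(LINT x|lebesgue_on \<Omega>. g x * \<phi> x) = (LINT x|lebesgue_on \<Omega>. g' x * \<phi> x)"
      using assms that by (force simp: has_weak_partial_def)
    then show ?thesis
      using integrable_L2_mult_continuous[OF assms(1,2) _ test_functions_continuous(1)[OF that]]
        assms(3,5)
      by (simp add: left_diff_distrib)
  qed
  \<comment> \<open>The constant 1 serves as the continuous multiplier, giving integrability of the
    difference itself.\<close>
  moreover have "integrable (lebesgue_on \<Omega>) (\<lambda>x. (g x - g' x) * 1)"
    using assms by (intro integrable_L2_mult_continuous L2_diff) auto
  ultimately have "AE x in lebesgue_on \<Omega>. g x - g' x = 0"
    using fundamental_lemma_calculus_of_variations[OF assms(1), of "\<lambda>x. g x - g' x"] by simp
  then show ?thesis
    by eventually_elim simp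
qed

lemma has_weak_partial_diff:
  fixes u v :: "real^'n \<Rightarrow> real"
  assumes "open \<Omega>" "bounded \<Omega>"
    and "u \<in> L2 (lebesgue_on \<Omega>)" "g \<in> L2 (lebesgue_on \<Omega>)" "has_weak_partial \<Omega> i u g"
    and "v \<in> L2 (lebesgue_on \<Omega>)" "g' \<in> L2 (lebesgue_on \<Omega>)" "has_weak_partial \<Omega> i v g'"
  shows "has_weak_partial \<Omega> i (\<lambda>x. u x - v x) (\<lambda>x. g x - g' x)"
  unfolding has_weak_partial_def
proof
  fix \<phi> :: "real^'n \<Rightarrow> real" assume \<phi>: "\<phi> \<in> test_functions \<Omega>"
  note int = integrable_L2_mult_continuous[OF assms(1,2) _ test_functions_continuous(1)[OF \<phi>]]
    integrable_L2_mult_continuous[OF assms(1,2) _ test_functions_continuous(2)[OF \<phi>]]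
  show "(LINT x|lebesgue_on \<Omega>. (u x - v x) * partial i \<phi> x) =
      - (LINT x|lebesgue_on \<Omega>. (g x - g' x) * \<phi> x)"
    using assms \<phi> int by (simp add: left_diff_distrib has_weak_partial_def)
qed

lemma H1_diff:
  fixes u v :: "real^'n \<Rightarrow> real"
  assumes "open \<Omega>" "bounded \<Omega>" "u \<in> H1 \<Omega>" "v \<in> H1 \<Omega>"
  shows "u - v \<in> H1 \<Omega>"
proof -
  have "\<exists>g\<in>L2 (lebesgue_on \<Omega>). has_weak_partial \<Omega> i (\<lambda>x. u x - v x) g" for i
  proof -
    obtain g g' where "g \<in> L2 (lebesgue_on \<Omega>)" "has_weak_partial \<Omega> i u g"
      "g' \<in> L2 (lebesgue_on \<Omega>)" "has_weak_partial \<Omega> i v g'"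
      using assms(3,4) unfolding H1_def by blast
    with assms show ?thesis
      by (intro bexI[of _ "\<lambda>x. g x - g' x"] has_weak_partial_diff L2_diff) (auto simp: H1_def)
  qed
  with assms show ?thesis
    by (simp add: H1_def L2_diff fun_diff_def)
qed

lemma weak_partial_H1:
  assumes "u \<in> H1 \<Omega>"
  shows "weak_partial \<Omega> i u \<in> L2 (lebesgue_on \<Omega>)" "has_weak_partial \<Omega> i u (weak_partial \<Omega> i u)"
proof -
  have "\<exists>g. g \<in> L2 (lebesgue_on \<Omega>) \<and> has_weak_partial \<Omega> i u g"
    using assms by (auto simp: H1_def)
  from someI_ex[OF this]
  show "weak_partial \<Omega> i u \<in> L2 (lebesgue_on \<Omega>)" "has_weak_partial \<Omega> i u (weak_partial \<Omega> i u)"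
    by (auto simp: weak_partial_def)
qed

lemma H1_uminus:
  assumes "u \<in> H1 \<Omega>"
  shows "- u \<in> H1 \<Omega>" "has_weak_partial \<Omega> i (- u) (\<lambda>x. - weak_partial \<Omega> i u x)"
proof -
  show *: "has_weak_partial \<Omega> i (- u) (\<lambda>x. - weak_partial \<Omega> i u x)" for i
    using weak_partial_H1(2)[OF assms, of i] by (simp add: has_weak_partial_def)
  then show "- u \<in> H1 \<Omega>"
    using assms L2_uminus[OF weak_partial_H1(1)[OF assms]] L2_uminus[of u]
    by (auto simp: H1_def fun_Compl_def)
qed

text \<open>The choices made for \<open>u\<close> and \<open>- u\<close> are unrelated pointwise;
  uniqueness ties them together up to a null set.\<close>

lemma weak_partial_uminus:
  assumes "open \<Omega>" "bounded \<Omega>" "u \<in> H1 \<Omega>"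
  shows "AE x in lebesgue_on \<Omega>. weak_partial \<Omega> i (- u) x = - weak_partial \<Omega> i u x"
  using has_weak_partial_unique[OF assms(1,2) weak_partial_H1[OF H1_uminus(1)]
      L2_uminus[OF weak_partial_H1(1)] H1_uminus(2)] assms(3) by blast

text \<open>The integrand changes sign almost everywhere, and \<open>integral_minus\<close> holds
  for arbitrary functions, so only measurability has to be supplied, for
  \<open>integral_cong_AE\<close>.\<close>

lemma A_op_uminus:
  fixes u w :: "real^'n \<Rightarrow> real"
  assumes "open \<Omega>" "bounded \<Omega>" "u \<in> H1 \<Omega>" "w \<in> H1 \<Omega>"
  shows "A_op \<Omega> b k u (- w) = - A_op \<Omega> b k u w"
proof -
  have [measurable]: "z \<in> borel_measurable (lebesgue_on \<Omega>)"
    "weak_partial \<Omega> i z \<in> borel_measurable (lebesgue_on \<Omega>)" if "z \<in> H1 \<Omega>" for z i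
    using that weak_partial_H1(1)[OF that, of i] by (auto simp: H1_def L2_def)
  note [measurable] = assms(3,4) H1_uminus(1)[OF assms(4)]
  \<comment> \<open>There are finitely many coordinates, so one null set serves all of them.\<close>
  have "AE x in lebesgue_on \<Omega>. \<forall>i\<in>UNIV. weak_partial \<Omega> i (- w) x = - weak_partial \<Omega> i w x"
    using weak_partial_uminus[OF assms(1,2,4)] by (intro AE_finite_allI) auto
  then have "A_op \<Omega> b k u (- w) = (LINT x|lebesgue_on \<Omega>.
      - ((\<Sum>i\<in>UNIV. weak_partial \<Omega> i u x * weak_partial \<Omega> i w x)
        + (\<Sum>i\<in>UNIV. b i * weak_partial \<Omega> i u x * w x) + k * u x * w x))"
    unfolding A_op_def
    by (intro integral_cong_AE) (measurable, auto elim!: eventually_mono simp: sum_negf)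
  then show ?thesis
    unfolding A_op_def Bochner_Integration.integral_minus .
qed

theorem lemma8:
  fixes \<Omega> :: "(real ^ 'n) set"
    and f h \<psi> us :: "real ^ 'n \<Rightarrow> real"
    and b :: "'n \<Rightarrow> real"
    and k Ca Cb \<gamma> :: real
    and K X Y :: "(real ^ 'n \<Rightarrow> real) set"
  assumes "bounded_lipschitz_domain \<Omega>"
    and "f \<in> L2 (lebesgue_on \<Omega>)"
    and "h \<in> H_half_boundary \<Omega>"
    and "\<psi> \<in> H1 \<Omega>"
    and "AE x in surface_measure \<Omega>. boundary_trace \<Omega> \<psi> x \<le> h x"
    and "K = obstacle_set \<Omega> \<psi> h"
    and "\<forall>i. b i \<ge> 0" and "k \<ge> 0"
    and "Ca > 0" and "Cb > 0"
    and "\<forall>u\<in>H1 \<Omega>. \<forall>v\<in>H1 \<Omega>.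
           H1_dual_norm \<Omega> (A_op \<Omega> b k u - A_op \<Omega> b k v) \<le> ereal (Cb * H1_norm \<Omega> (u - v))"
    and "\<forall>u\<in>H1 \<Omega>. \<forall>v\<in>H1 \<Omega>.
           (A_op \<Omega> b k u - A_op \<Omega> b k v) (u - v) \<ge> Ca * (H1_norm \<Omega> (u - v))\<^sup>2"
    and "VI_solution \<Omega> b k f K us"
    and "us \<in> X \<inter> Y"
    and "K \<inter> X \<subseteq> K \<inter> Y"
    and "H1_convex (K \<inter> Y)" and "H1_closed \<Omega> (K \<inter> Y)"
    and "\<gamma> > 0"
  shows "(\<forall>u\<in>H1 \<Omega>.
            ereal ((Ca - 1 / (2 * \<gamma>)) * (H1_norm \<Omega> (u - us))\<^sup>2
                   + (A_op \<Omega> b k us - L2_functional \<Omega> f) (u - us))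
              \<le> G_gap \<Omega> b k f (K \<inter> Y) \<gamma> u) \<and>
         (\<forall>u\<in>K. ereal ((Ca - 1 / (2 * \<gamma>)) * (H1_norm \<Omega> (u - us))\<^sup>2)
              \<le> G_gap \<Omega> b k f (K \<inter> Y) \<gamma> u)"
proof -
  have \<Omega>: "open \<Omega>" "bounded \<Omega>"
    using assms(1) by (auto simp: bounded_lipschitz_domain_def)
  have us: "us \<in> K \<inter> Y" "us \<in> H1 \<Omega>"
    using assms(6,13,14) by (auto simp: VI_solution_def obstacle_set_def)
  have gap: "ereal ((Ca - 1 / (2 * \<gamma>)) * (H1_norm \<Omega> (u - us))\<^sup>2
      + (A_op \<Omega> b k us - L2_functional \<Omega> f) (u - us)) \<le> G_gap \<Omega> b k f (K \<inter> Y) \<gamma> u"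
    if "u \<in> H1 \<Omega>" for u
  proof -
    have "Ca * (H1_norm \<Omega> (u - us))\<^sup>2 \<le> (A_op \<Omega> b k u - A_op \<Omega> b k us) (u - us)"
      using assms(12) that us(2) by blast
    \<comment> \<open>\<open>A u - f\<close> splits as \<open>(A u - A us) + (A us - f)\<close>,
      evaluated at the common argument \<open>u - us\<close>; the penalty term is subtracted on both
      sides.\<close>
    then have "(Ca - 1 / (2 * \<gamma>)) * (H1_norm \<Omega> (u - us))\<^sup>2
        + (A_op \<Omega> b k us - L2_functional \<Omega> f) (u - us)
      \<le> (A_op \<Omega> b k u - L2_functional \<Omega> f) (u - us) - 1 / (2 * \<gamma>) * (H1_norm \<Omega> (u - us))\<^sup>2"
      by (simp add: left_diff_distrib)
    also have "ereal \<dots> \<le> G_gap \<Omega> b k f (K \<inter> Y) \<gamma> u"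
      \<comment> \<open>\<open>us\<close> lies in \<open>K \<inter> Y\<close>, hence competes in the
        supremum.\<close>
      unfolding G_gap_def using us(1) by (intro SUP_upper)
    finally show ?thesis by simp
  qed
  \<comment> \<open>The variational inequality is stated at \<open>us - u\<close>, whereas the
    estimate contains \<open>u - us\<close>; both functionals are therefore evaluated at the negated
    argument.\<close>
  have "0 \<le> (A_op \<Omega> b k us - L2_functional \<Omega> f) (u - us)" if "u \<in> K" for u
  proof -
    have "u - us \<in> H1 \<Omega>"
      using that us(2) assms(6) \<Omega> by (intro H1_diff) (auto simp: obstacle_set_def)
    then have "A_op \<Omega> b k us (- (u - us)) = - A_op \<Omega> b k us (u - us)"
      by (intro A_op_uminus \<Omega> us(2))
    moreover have "L2_functional \<Omega> f (- (u - us)) = - L2_functional \<Omega> f (u - us)"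
      unfolding L2_functional_def by (simp flip: Bochner_Integration.integral_minus add: algebra_simps)
    moreover have "us - u = - (u - us)"
      by auto
    moreover have "(A_op \<Omega> b k us - L2_functional \<Omega> f) (us - u) \<le> 0"
      using assms(13) that by (simp add: VI_solution_def)
    ultimately show ?thesis
      by simp
  qed
  \<comment> \<open>Dropping the nonnegative duality term only decreases the left side of
    \<open>gap\<close>.\<close>
  then have "ereal ((Ca - 1 / (2 * \<gamma>)) * (H1_norm \<Omega> (u - us))\<^sup>2) \<le> G_gap \<Omega> b k f (K \<inter> Y) \<gamma> u"
    if "u \<in> K" for u
    using that assms(6) by (intro order_trans[OF _ gap]) (auto simp: obstacle_set_def)
  with gap show ?thesis
    by blast
qed

end
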